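(* Let $E$ be a finite set of equations. If there exists a run of MMA on $E$ in which action (6) is not performed, then MMA$^-$ is sound for $E$: every run of MMA$^-$ on $E$ halts with failure if $E$ is not unifiable, and otherwise produces a unifiable equation set $E'$ in semi-solved form (so that iteratively applying action (5) of MMA to $E'$ yields an equation set in solved form representing an mgu of $E$).
   Context: MMA (Martelli–Montanari algorithm) operates on a finite set of equations by nondeterministically choosing an equation and applying one of: (1) $f(s_1,\ldots,s_n)\doteq f(t_1,\ldots,t_n)$: replace by $s_1\doteq t_1,\ldots,s_n\doteq t_n$; (2) $f(\ldots)\doteq g(\ldots)$ with $f\neq g$: halt with failure; (3) $X\doteq X$: delete; (4) $t\doteq X$ with $t$ not a variable: replace by $X\doteq t$; (5) $X\doteq t$ with $X\notin Var(t)$ and $X$ occurring elsewhere: apply $\{X/t\}$ to all other equations; (6) $X\doteq t$ with $X\in Var(t)$ and $X\neq t$: halt with failure. A run is a maximal sequence of equation sets each obtained from the previous by one action. MMA$^-$ has actions (1)–(4) of MMA and, instead of (5) and (6): (5a) $X\doteq Y$ with $X,Y$ distinct variables and $X$ occurring elsewhere: apply $\{X/Y\}$ to all other equations; (5b) two equations $X\doteq t$, $X\doteq u$ with $t,u$ distinct non-variable terms: letting $\{s_1,s_2\}=\{t,u\}$ with $|s_1|\le|s_2|$ ($|\cdot|$ = number of occurrences of variables and function symbols), replace $X\doteq s_2$ by $s_1\doteq s_2$. A set is in semi-solved form if it is $\{X_1\doteq t_1,\ldots,X_n\doteq t_n\}$ with distinct variables $X_i$, each $X_i\neq t_i$, and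 $X_i$ occurring only once in the set whenever $t_i$ is a variable; it is in solved form if moreover no $X_i$ occurs in any $t_j$, and then $\{X_1/t_1,\ldots,X_n/t_n\}$ is the represented mgu. *)

theory Defs
  imports Main "HOL-Library.Extended_Nat"
begin

text \<open>
  First-order terms.  A function symbol is identified by its name together with the number of
  arguments it is applied to, so \<open>Fun f ss\<close> and \<open>Fun f ts\<close> have different main symbols when
  \<open>length ss \<noteq> length ts\<close>.
\<close>

datatype (fsyms: 'f, vars: 'v) trm =
    is_Var: Var 'v
  | Fun 'f "('f, 'v) trm list"

type_synonym ('f, 'v) eqn = "('f, 'v) trm \<times> ('f, 'v) trm"
type_synonym ('f, 'v) eqns = "('f, 'v) eqn set"
type_synonym ('f, 'v) subst = "'v \<Rightarrow> ('f, 'v) trm"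

primrec trm_size :: "('f, 'v) trm \<Rightarrow> nat" where
  "trm_size (Var X) = 1"
| "trm_size (Fun f ts) = 1 + sum_list (map trm_size ts)"

primrec occ :: "'v \<Rightarrow> ('f, 'v) trm \<Rightarrow> nat" where
  "occ X (Var Y) = (if X = Y then 1 else 0)"
| "occ X (Fun f ts) = sum_list (map (occ X) ts)"

definition occ_eqns :: "'v \<Rightarrow> ('f, 'v) eqns \<Rightarrow> nat" where
  "occ_eqns X E = (\<Sum>(s, t)\<in>E. occ X s + occ X t)"

definition vars_eqns :: "('f, 'v) eqns \<Rightarrow> 'v set" where
  "vars_eqns E = (\<Union>(s, t)\<in>E. vars s \<union> vars t)"

primrec app :: "('f, 'v) subst \<Rightarrow> ('f, 'v) trm \<Rightarrow> ('f, 'v) trm" where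
  "app \<sigma> (Var X) = \<sigma> X"
| "app \<sigma> (Fun f ts) = Fun f (map (app \<sigma>) ts)"

definition app_eqns :: "('f, 'v) subst \<Rightarrow> ('f, 'v) eqns \<Rightarrow> ('f, 'v) eqns" where
  "app_eqns \<sigma> E = (\<lambda>(s, t). (app \<sigma> s, app \<sigma> t)) ` E"

text \<open>Substitutions proper are the functions that move only finitely many variables.\<close>

definition is_subst :: "('f, 'v) subst \<Rightarrow> bool" where
  "is_subst \<sigma> \<longleftrightarrow> finite {X. \<sigma> X \<noteq> Var X}"

definition is_unifier :: "('f, 'v) subst \<Rightarrow> ('f, 'v) eqns \<Rightarrow> bool" where
  "is_unifier \<sigma> E \<longleftrightarrow> is_subst \<sigma> \<and> (\<forall>(s, t)\<in>E. app \<sigma> s = app \<sigma> t)"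

definition unifiable :: "('f, 'v) eqns \<Rightarrow> bool" where
  "unifiable E \<longleftrightarrow> (\<exists>\<sigma>. is_unifier \<sigma> E)"

definition is_mgu :: "('f, 'v) subst \<Rightarrow> ('f, 'v) eqns \<Rightarrow> bool" where
  "is_mgu \<sigma> E \<longleftrightarrow> is_unifier \<sigma> E \<and>
     (\<forall>\<theta>. is_unifier \<theta> E \<longrightarrow> (\<exists>\<tau>. is_subst \<tau> \<and> (\<forall>X. \<theta> X = app \<tau> (\<sigma> X))))"

datatype action = Act1 | Act2 | Act3 | Act4 | Act5 | Act6 | Act5a | Act5b

datatype ('f, 'v) state = Failure | Eqns "('f, 'v) eqns"

text \<open>
  \<open>act a S S'\<close>: action \<open>a\<close> leads from \<open>S\<close> to \<open>S'\<close>.  A variable of an equation occurs elsewhere if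
  it occurs in the set without that equation.  If the two terms in \<open>Act5b\<close> have equal size,
  either of the two equations may be the one that is replaced.
\<close>

inductive act :: "action \<Rightarrow> ('f, 'v) state \<Rightarrow> ('f, 'v) state \<Rightarrow> bool" where
  act1: "(Fun f ss, Fun f ts) \<in> E \<Longrightarrow> length ss = length ts \<Longrightarrow>
    act Act1 (Eqns E) (Eqns (E - {(Fun f ss, Fun f ts)} \<union> set (zip ss ts)))"
| act2: "(Fun f ss, Fun g ts) \<in> E \<Longrightarrow> f \<noteq> g \<or> length ss \<noteq> length ts \<Longrightarrow>
    act Act2 (Eqns E) Failure"
| act3: "(Var X, Var X) \<in> E \<Longrightarrow>
    act Act3 (Eqns E) (Eqns (E - {(Var X, Var X)}))"
| act4: "(t, Var X) \<in> E \<Longrightarrow> \<not> is_Var t \<Longrightarrow>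
    act Act4 (Eqns E) (Eqns (E - {(t, Var X)} \<union> {(Var X, t)}))"
| act5: "(Var X, t) \<in> E \<Longrightarrow> X \<notin> vars t \<Longrightarrow> X \<in> vars_eqns (E - {(Var X, t)}) \<Longrightarrow>
    act Act5 (Eqns E) (Eqns (app_eqns (Var(X := t)) (E - {(Var X, t)}) \<union> {(Var X, t)}))"
| act6: "(Var X, t) \<in> E \<Longrightarrow> X \<in> vars t \<Longrightarrow> Var X \<noteq> t \<Longrightarrow>
    act Act6 (Eqns E) Failure"
| act5a: "(Var X, Var Y) \<in> E \<Longrightarrow> X \<noteq> Y \<Longrightarrow> X \<in> vars_eqns (E - {(Var X, Var Y)}) \<Longrightarrow>
    act Act5a (Eqns E)
      (Eqns (app_eqns (Var(X := Var Y)) (E - {(Var X, Var Y)}) \<union> {(Var X, Var Y)}))"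
| act5b: "(Var X, s1) \<in> E \<Longrightarrow> (Var X, s2) \<in> E \<Longrightarrow> s1 \<noteq> s2 \<Longrightarrow> \<not> is_Var s1 \<Longrightarrow> \<not> is_Var s2 \<Longrightarrow>
    trm_size s1 \<le> trm_size s2 \<Longrightarrow>
    act Act5b (Eqns E) (Eqns (E - {(Var X, s2)} \<union> {(s1, s2)}))"

definition MMA :: "action set" where
  "MMA = {Act1, Act2, Act3, Act4, Act5, Act6}"

definition MMA_minus :: "action set" where
  "MMA_minus = {Act1, Act2, Act3, Act4, Act5a, Act5b}"

text \<open>
  A run from \<open>E\<close> with actions from \<open>A\<close> performs \<open>n\<close> actions, where \<open>n = \<infinity>\<close> is allowed: \<open>L i\<close> leads
  from \<open>S i\<close> to \<open>S (Suc i)\<close> for \<open>i < n\<close>.  Values of \<open>S\<close> beyond \<open>n\<close>, and of \<open>L\<close> from \<open>n\<close> on, are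
  irrelevant.  The last condition is maximality.
\<close>

definition is_run ::
  "action set \<Rightarrow> ('f, 'v) eqns \<Rightarrow> enat \<Rightarrow> (nat \<Rightarrow> ('f, 'v) state) \<Rightarrow> (nat \<Rightarrow> action) \<Rightarrow> bool" where
  "is_run A E n S L \<longleftrightarrow>
     S 0 = Eqns E \<and>
     (\<forall>i. enat i < n \<longrightarrow> L i \<in> A \<and> act (L i) (S i) (S (Suc i))) \<and>
     (\<forall>k. n = enat k \<longrightarrow> \<not> (\<exists>a\<in>A. \<exists>S'. act a (S k) S'))"

definition semi_solved :: "('f, 'v) eqns \<Rightarrow> bool" where
  "semi_solved E \<longleftrightarrow>
     finite E \<and>
     (\<forall>(s, t)\<in>E. is_Var s \<and> s \<noteq> t) \<and>
     (\<forall>X t u. (Var X, t) \<in> E \<longrightarrow> (Var X, u) \<in> E \<longrightarrow> t = u) \<and>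
     (\<forall>X t. (Var X, t) \<in> E \<longrightarrow> is_Var t \<longrightarrow> occ_eqns X E = 1)"

definition solved :: "('f, 'v) eqns \<Rightarrow> bool" where
  "solved E \<longleftrightarrow>
     semi_solved E \<and> (\<forall>X t s u. (Var X, t) \<in> E \<longrightarrow> (s, u) \<in> E \<longrightarrow> X \<notin> vars u)"

definition represented_subst :: "('f, 'v) eqns \<Rightarrow> ('f, 'v) subst" where
  "represented_subst E X =
     (if \<exists>t. (Var X, t) \<in> E then THE t. (Var X, t) \<in> E else Var X)"

end

theory Submission
  imports Defs
begin

text \<open>
  Consider the congruences of the term algebra that identify two compound terms exactly if their
  main symbols agree and their arguments are pairwise identified.  Kernels of substitutions are of
  this kind, and so is equality of the rational trees described by a semi-solved set, even if that
  set is not unifiable.  No action changes which of these congruences contain the equation set,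
  and a clash (action 2) excludes all of them.  If \<open>E\<close> is not unifiable, then the run of MMA without
  action 6 ends with a clash, hence no such congruence contains \<open>E\<close>, and so no run of MMA-minus
  can end in a semi-solved set.  All runs are finite because one
  lexicographic measure, led by the number of unsolved variables, decreases under every action.
\<close>

section \<open>Variables and substitutions\<close>

lemma vars_eqns_simps [simp]:
  "vars_eqns {} = {}"
  "vars_eqns (insert (s, t) E) = vars s \<union> vars t \<union> vars_eqns E"
  "vars_eqns (E \<union> F) = vars_eqns E \<union> vars_eqns F"
  by (auto simp: vars_eqns_def)

lemma vars_eqns_mono: "E \<subseteq> F \<Longrightarrow> vars_eqns E \<subseteq> vars_eqns F"
  by (auto simp: vars_eqns_def)

lemma vars_eqns_memD: "(s, t) \<in> E \<Longrightarrow> vars s \<union> vars t \<subseteq> vars_eqns E"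
  by (auto simp: vars_eqns_def)

lemma vars_eqns_lhsI: "(s, t) \<in> E \<Longrightarrow> X \<in> vars s \<Longrightarrow> X \<in> vars_eqns E"
  and vars_eqns_rhsI: "(s, t) \<in> E \<Longrightarrow> X \<in> vars t \<Longrightarrow> X \<in> vars_eqns E"
  by (auto simp: vars_eqns_def)

lemma finite_vars: "finite (vars t)"
  by (induction t) auto

lemma finite_vars_eqns: "finite E \<Longrightarrow> finite (vars_eqns E)"
  by (auto simp: vars_eqns_def finite_vars)

lemma occ_eq_0_iff: "occ X t = 0 \<longleftrightarrow> X \<notin> vars t"
  by (induction t) auto

lemma vars_app: "vars (app \<sigma> t) = (\<Union>X\<in>vars t. vars (\<sigma> X))"
  by (induction t) auto

lemma vars_app_upd:
  "vars (app (Var(X := t)) u) = (vars u - {X}) \<union> (if X \<in> vars u then vars t else {})"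
  by (auto simp: vars_app split: if_splits)

lemma vars_eqns_app_upd:
  "vars_eqns (app_eqns (Var(X := t)) E) =
     (vars_eqns E - {X}) \<union> (if X \<in> vars_eqns E then vars t else {})"
proof -
  have "vars_eqns (app_eqns (Var(X := t)) E) =
      (\<Union>(s, u)\<in>E. vars (app (Var(X := t)) s) \<union> vars (app (Var(X := t)) u))"
    by (force simp: vars_eqns_def app_eqns_def)
  also have "\<dots> = (\<Union>(s, u)\<in>E. (vars s \<union> vars u) - {X} \<union>
      (if X \<in> vars s \<union> vars u then vars t else {}))"
    by (intro SUP_cong refl) (auto simp: vars_app_upd split: if_splits)
  also have "\<dots> = (vars_eqns E - {X}) \<union> (if X \<in> vars_eqns E then vars t else {})"
    by (auto simp: vars_eqns_def split: if_splits)
  finally show ?thesis .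
qed

lemma app_idI: "(\<And>X. X \<in> vars t \<Longrightarrow> \<sigma> X = Var X) \<Longrightarrow> app \<sigma> t = t"
  by (induction t) (auto intro: map_idI)

lemma trm_size_pos: "0 < trm_size t"
  by (cases t) auto

lemma trm_size_app_var: "X \<in> vars t \<Longrightarrow> trm_size (\<sigma> X) \<le> trm_size (app \<sigma> t)"
proof (induction t)
  case (Fun f ts)
  then obtain t where t: "t \<in> set ts" "X \<in> vars t" by auto
  then have "trm_size (\<sigma> X) \<le> trm_size (app \<sigma> t)" using Fun by blast
  also have "\<dots> \<le> sum_list (map (\<lambda>t. trm_size (app \<sigma> t)) ts)"
    using t by (intro member_le_sum_list) auto
  finally show ?case by (simp add: comp_def)
qed simp

lemma trm_size_app_var_less:
  assumes "X \<in> vars t" "t \<noteq> Var X"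
  shows "trm_size (\<sigma> X) < trm_size (app \<sigma> t)"
proof (cases t)
  case (Fun f ts)
  then obtain t' where t: "t' \<in> set ts" "X \<in> vars t'" using assms by auto
  then have "trm_size (\<sigma> X) \<le> trm_size (app \<sigma> t')" by (simp add: trm_size_app_var)
  also have "\<dots> \<le> sum_list (map (\<lambda>t. trm_size (app \<sigma> t)) ts)"
    using t by (intro member_le_sum_list) auto
  finally show ?thesis by (simp add: Fun comp_def)
qed (use assms in auto)

text \<open>For compound \<open>t\<close>, a unifier would make \<open>app \<sigma> t\<close>
  strictly larger than the copy of \<open>\<sigma> X\<close> inside it.\<close>

lemma unifiable_occurs_check:
  "unifiable E \<Longrightarrow> (Var X, t) \<in> E \<Longrightarrow> X \<in> vars t \<Longrightarrow> t = Var X"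
proof (rule ccontr)
  assume "unifiable E" "(Var X, t) \<in> E" and occ: "X \<in> vars t" "t \<noteq> Var X"
  then obtain \<sigma> where "\<sigma> X = app \<sigma> t" by (auto simp: unifiable_def is_unifier_def)
  then show False using trm_size_app_var_less[OF occ, of \<sigma>] by simp
qed

section \<open>Termination\<close>

lemma act_from_Failure: "\<not> act a Failure S"
  by (auto elim: act.cases)

text \<open>This lets both the termination argument and the invariance argument treat action 5
  only.\<close>

lemma act5a_imp_act5: "act Act5a S S' \<Longrightarrow> act Act5 S S'"
  by (erule act.cases) (auto intro: act5[of _ "Var _", simplified])

lemma act_finite:
  assumes "act a (Eqns E) (Eqns E')" "finite E"
  shows "finite E'"
  using assms by (auto elim!: act.cases simp: app_eqns_def)

text \<open>Actions 5 and 5a give the chosen variable this property, and no action takes it away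
  from a variable. So the number of variables without it can lead the measure.\<close>

definition solved_var :: "'v \<Rightarrow> ('f, 'v) eqns \<Rightarrow> bool" where
  "solved_var X E \<longleftrightarrow>
     (\<exists>t. (Var X, t) \<in> E \<and> X \<notin> vars t \<and> X \<notin> vars_eqns (E - {(Var X, t)}))"

definition unsolved_vars :: "('f, 'v) eqns \<Rightarrow> 'v set" where
  "unsolved_vars E = {X \<in> vars_eqns E. \<not> solved_var X E}"

lemma finite_unsolved_vars: "finite E \<Longrightarrow> finite (unsolved_vars E)"
  by (simp add: unsolved_vars_def finite_vars_eqns)

text \<open>\<open>G\<close> holds the equations that an action inspects; \<open>e\<close> is the
  one replaced by \<open>F\<close>. The equation of a solved variable lies outside \<open>G\<close>,
  hence it survives, and the variable occurs neither in \<open>G\<close> nor in \<open>F\<close>. In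
  action 5b \<open>G\<close> has two members, because the left side of the new equation comes from
  the equation that is kept.\<close>

lemma unsolved_vars_replace:
  assumes "e \<in> G" "G \<subseteq> E" "vars_eqns F \<subseteq> vars_eqns G"
    and G: "\<And>X t. (Var X, t) \<in> G \<Longrightarrow> \<not> solved_var X E"
  shows "unsolved_vars (E - {e} \<union> F) \<subseteq> unsolved_vars E"
proof -
  have "vars_eqns (E - {e} \<union> F) \<subseteq> vars_eqns E"
    using assms(2,3) vars_eqns_mono[of G E] vars_eqns_mono[of "E - {e}" E] by auto
  moreover have "solved_var X (E - {e} \<union> F)" if X: "solved_var X E" for X
  proof -
    from X obtain t where t: "(Var X, t) \<in> E" "X \<notin> vars t" "X \<notin> vars_eqns (E - {(Var X, t)})"
      by (auto simp: solved_var_def)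
    have notG: "(Var X, t) \<notin> G" using G X by blast
    then have "G \<subseteq> E - {(Var X, t)}" using assms(2) by blast
    then have "X \<notin> vars_eqns F" using assms(3) t(3) vars_eqns_mono by blast
    moreover have "X \<notin> vars_eqns (E - {e} - {(Var X, t)})"
      using t(3) vars_eqns_mono[of "E - {e} - {(Var X, t)}" "E - {(Var X, t)}"] by blast
    moreover have "X \<notin> vars_eqns (F - {(Var X, t)})"
      using \<open>X \<notin> vars_eqns F\<close> vars_eqns_mono[of "F - {(Var X, t)}" F] by blast
    ultimately show ?thesis
      unfolding solved_var_def using t notG assms(1)
      by (intro exI[of _ t]) (auto simp: Un_Diff)
  qed
  ultimately show ?thesis by (auto simp: unsolved_vars_def)
qed

text \<open>The substitution erases all other occurrences of \<open>X\<close>, so \<open>X\<close>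
  becomes solved. Another solved variable \<open>Y\<close> stays solved: \<open>(Var X, t)\<close>
  is not the equation of \<open>Y\<close>, so \<open>Y\<close> does not occur in \<open>t\<close>
  and is not copied.\<close>

lemma unsolved_vars_act5:
  assumes "(Var X, t) \<in> E" "X \<notin> vars t" "X \<in> vars_eqns (E - {(Var X, t)})"
  shows "unsolved_vars (app_eqns (Var(X := t)) (E - {(Var X, t)}) \<union> {(Var X, t)}) \<subset> unsolved_vars E"
    (is "unsolved_vars ?E' \<subset> _")
proof -
  let ?\<sigma> = "Var(X := t)" and ?D = "E - {(Var X, t)}"
  have split: "vars_eqns E = insert X (vars t) \<union> vars_eqns ?D"
    using assms(1) vars_eqns_simps(2)[of "Var X" t ?D] by (simp add: insert_absorb)
  have vars: "vars_eqns ?E' \<subseteq> vars_eqns E"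
    unfolding split by (auto simp: vars_eqns_app_upd split: if_splits)
  have X: "X \<in> unsolved_vars E"
    unfolding unsolved_vars_def solved_var_def
  proof safe
    show "X \<in> vars_eqns E" by (simp add: split)
  next
    fix u assume u: "(Var X, u) \<in> E" "X \<notin> vars u" "X \<notin> vars_eqns (E - {(Var X, u)})"
    show False
    proof (cases "u = t")
      case False
      then have "(Var X, t) \<in> E - {(Var X, u)}" using assms(1) by auto
      then show False using u(3) vars_eqns_lhsI[of "Var X" t] by auto
    qed (use u assms in auto)
  qed
  have X_new: "X \<notin> vars_eqns (app_eqns ?\<sigma> ?D)" using assms(2) by (simp add: vars_eqns_app_upd)
  moreover have "?E' - {(Var X, t)} \<subseteq> app_eqns ?\<sigma> ?D" by auto
  ultimately have "X \<notin> vars_eqns (?E' - {(Var X, t)})" using vars_eqns_mono by blast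
  then have "solved_var X ?E'" using assms(2) by (auto simp: solved_var_def)
  then have X': "X \<notin> unsolved_vars ?E'" by (simp add: unsolved_vars_def)
  have "solved_var Y ?E'" if Y: "solved_var Y E" for Y
  proof -
    from Y obtain u where u: "(Var Y, u) \<in> E" "Y \<notin> vars u" "Y \<notin> vars_eqns (E - {(Var Y, u)})"
      by (auto simp: solved_var_def)
    have "Y \<noteq> X" using X Y by (auto simp: unsolved_vars_def)
    then have "(Var X, t) \<in> E - {(Var Y, u)}" using assms(1) by auto
    from vars_eqns_rhsI[OF this] have Yt: "Y \<notin> vars t" using u(3) by blast
    let ?u = "app ?\<sigma> u"
    have "(Var Y, u) \<in> ?D" using u \<open>Y \<noteq> X\<close> by auto
    then have "(app ?\<sigma> (Var Y), ?u) \<in> app_eqns ?\<sigma> ?D" unfolding app_eqns_def by force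
    then have mem: "(Var Y, ?u) \<in> ?E'" using \<open>Y \<noteq> X\<close> by simp
    have "?E' - {(Var Y, ?u)} \<subseteq> app_eqns ?\<sigma> (?D - {(Var Y, u)}) \<union> {(Var X, t)}"
      using \<open>Y \<noteq> X\<close> by (auto simp: app_eqns_def)
    moreover have "Y \<notin> vars_eqns (?D - {(Var Y, u)})"
      using u(3) vars_eqns_mono[of "?D - {(Var Y, u)}" "E - {(Var Y, u)}"] by blast
    then have "Y \<notin> vars_eqns (app_eqns ?\<sigma> (?D - {(Var Y, u)}) \<union> {(Var X, t)})"
      using Yt \<open>Y \<noteq> X\<close> by (simp add: vars_eqns_app_upd)
    ultimately have "Y \<notin> vars_eqns (?E' - {(Var Y, ?u)})" using vars_eqns_mono by blast
    moreover have "Y \<notin> vars ?u" using Yt u(2) by (simp add: vars_app_upd)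
    ultimately show ?thesis using mem unfolding solved_var_def by blast
  qed
  then show ?thesis using vars X X' by (auto simp: unsolved_vars_def)
qed

text \<open>
  Action 5b does not increase the larger size \<open>m\<close> of the two sides of an equation.  Decomposing an
  equation yields equations with values at most \<open>m - 1\<close> whose sum is at most \<open>2 * (m - 1)\<close>, and
  \<open>2 * (m - 1) * 2 ^ (m - 1) < m * 2 ^ m\<close>.
\<close>

definition eqn_weight :: "('f, 'v) eqn \<Rightarrow> nat" where
  "eqn_weight e = (let m = max (trm_size (fst e)) (trm_size (snd e)) in m * 2 ^ m)"

text \<open>Breaks the ties of the weight: actions 4 and 5b keep the weight of the replaced
  equation, while its rank falls from 2 to 1 under action 4 and from 1 to 0 under action 5b.\<close>

definition eqn_rank :: "('f, 'v) eqn \<Rightarrow> nat" where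
  "eqn_rank e = (if is_Var (fst e) then 1 else if is_Var (snd e) then 2 else 0)"

lemma eqn_weight_pos: "0 < eqn_weight e"
  by (simp add: eqn_weight_def Let_def trm_size_pos less_max_iff_disj)

text \<open>Only an inequality, since a member of \<open>F\<close> may already be present in
  \<open>E\<close> and is then counted once.\<close>

lemma sum_replace_le:
  fixes w :: "'a \<Rightarrow> nat"
  assumes "finite E" "finite F" "e \<in> E"
  shows "sum w (E - {e} \<union> F) + w e \<le> sum w E + sum w F"
proof -
  have "sum w (E - {e} \<union> F) \<le> sum w (E - {e}) + sum w F"
    using assms sum_Un_nat[of "E - {e}" F w] by simp
  then show ?thesis using assms sum.remove[of E e w] by simp
qed

lemma sum_set_le_sum_list:
  fixes w :: "'a \<Rightarrow> nat"
  shows "sum w (set xs) \<le> sum_list (map w xs)"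
  by (induction xs) (auto simp: sum.insert_if)

lemma sum_list_max_zip_le:
  assumes "length ss = length ts"
  shows "sum_list (map (\<lambda>(s, t). max (trm_size s) (trm_size t)) (zip ss ts))
    \<le> sum_list (map trm_size ss) + sum_list (map trm_size ts)"
  using assms by (induction ss ts rule: list_induct2) auto

lemma sum_eqn_weight_zip_less:
  assumes len: "length ss = length ts"
  shows "sum eqn_weight (set (zip ss ts)) < eqn_weight (Fun f ss, Fun f ts)"
proof -
  \<comment> \<open>\<open>M\<close> is the larger size of the two sides minus one, for the dropped
    root symbol.\<close>
  define M where "M = max (sum_list (map trm_size ss)) (sum_list (map trm_size ts))"
  let ?m = "\<lambda>(s, t). max (trm_size s) (trm_size t)"
  have "eqn_weight e \<le> ?m e * 2 ^ M" if "e \<in> set (zip ss ts)" for e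
  proof -
    obtain s t where e: "e = (s, t)" by fastforce
    then have "s \<in> set ss" "t \<in> set ts" using that by (auto dest: set_zip_leftD set_zip_rightD)
    then have "trm_size s \<le> sum_list (map trm_size ss)" "trm_size t \<le> sum_list (map trm_size ts)"
      by (auto intro!: member_le_sum_list)
    then have "trm_size s \<le> M" "trm_size t \<le> M"
      unfolding M_def by linarith+
    then show ?thesis by (simp add: e eqn_weight_def Let_def power_increasing)
  qed
  then have "sum_list (map eqn_weight (zip ss ts)) \<le> sum_list (map (\<lambda>e. ?m e * 2 ^ M) (zip ss ts))"
    by (intro sum_list_mono) auto
  also have "\<dots> = sum_list (map ?m (zip ss ts)) * 2 ^ M"
    by (simp add: sum_list_mult_const)
  also have "\<dots> \<le> (2 * M) * 2 ^ M"
    using sum_list_max_zip_le[OF len] unfolding M_def by (intro mult_right_mono) auto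
  also have "\<dots> < Suc M * 2 ^ Suc M" by simp
  also have "\<dots> = eqn_weight (Fun f ss, Fun f ts)"
    by (simp add: eqn_weight_def Let_def M_def)
  finally show ?thesis using sum_set_le_sum_list[of eqn_weight "zip ss ts"] by linarith
qed

section \<open>The lexicographic measure and its decrease\<close>

definition eqns_measure :: "('f, 'v) eqns \<Rightarrow> nat \<times> nat \<times> nat" where
  "eqns_measure E = (card (unsolved_vars E), sum eqn_weight E, sum eqn_rank E)"

abbreviation measure_less :: "((nat \<times> nat \<times> nat) \<times> (nat \<times> nat \<times> nat)) set" where
  "measure_less \<equiv> less_than <*lex*> less_than <*lex*> less_than"

text \<open>Common to actions 1, 3, 4 and 5b: the leading component does not grow, so the decrease
  of weight or rank decides.\<close>

lemma eqns_measure_replace: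
  assumes "finite E" "finite F" "e \<in> G" "G \<subseteq> E" "vars_eqns F \<subseteq> vars_eqns G"
    and "\<And>X t. (Var X, t) \<in> G \<Longrightarrow> \<not> solved_var X E"
    and less: "sum eqn_weight F < eqn_weight e \<or>
      sum eqn_weight F \<le> eqn_weight e \<and> sum eqn_rank F < eqn_rank e"
  shows "(eqns_measure (E - {e} \<union> F), eqns_measure E) \<in> measure_less"
proof -
  have e: "e \<in> E" using assms by blast
  have "card (unsolved_vars (E - {e} \<union> F)) \<le> card (unsolved_vars E)"
    using assms unsolved_vars_replace[of e G E F] by (intro card_mono finite_unsolved_vars) auto
  then show ?thesis
    using less sum_replace_le[OF assms(1,2) e, of eqn_weight]
      sum_replace_le[OF assms(1,2) e, of eqn_rank]
    unfolding eqns_measure_def by auto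
qed

lemma act_decreases_measure:
  assumes "act a (Eqns E) (Eqns E')" "finite E"
  shows "(eqns_measure E', eqns_measure E) \<in> measure_less"
proof -
  \<comment> \<open>Settled first because action 5a reduces to it. Weights may grow here; the number
    of unsolved variables falls.\<close>
  have act5: ?thesis if "act Act5 (Eqns E) (Eqns E')"
    using that
  proof cases
    case (act5 X t)
    then have "card (unsolved_vars E') < card (unsolved_vars E)"
      using unsolved_vars_act5[of X t E] assms(2)
      by (auto intro!: psubset_card_mono finite_unsolved_vars)
    then show ?thesis by (simp add: eqns_measure_def)
  qed
  show ?thesis using assms(1)
  proof cases
    case (act1 f ss ts)
    have "vars_eqns (set (zip ss ts)) \<subseteq> vars_eqns {(Fun f ss, Fun f ts)}"
      by (auto simp: vars_eqns_def dest: set_zip_leftD set_zip_rightD)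
    with act1 show ?thesis using sum_eqn_weight_zip_less[of ss ts f] assms(2)
      unfolding act1(2)
      by (intro eqns_measure_replace[where G = "{(Fun f ss, Fun f ts)}"]) auto
  next
    case (act3 X)
    \<comment> \<open>A witnessing equation has no \<open>X\<close> on its right, so it differs from
      \<open>(Var X, Var X)\<close>, which is then another occurrence of \<open>X\<close>.\<close>
    have "\<not> solved_var X E"
    proof
      assume "solved_var X E"
      then obtain t where "X \<notin> vars t" "X \<notin> vars_eqns (E - {(Var X, t)})"
        by (auto simp: solved_var_def)
      moreover from this have "(Var X, Var X) \<in> E - {(Var X, t)}" using act3(3) by auto
      ultimately show False using vars_eqns_lhsI[of "Var X" "Var X" "E - {(Var X, t)}"] by simp
    qed
    then show ?thesis
      using eqns_measure_replace[of E "{}" "(Var X, Var X)" "{(Var X, Var X)}"]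
        act3 assms(2) eqn_weight_pos by auto
  next
    case (act4 t X)
    then show ?thesis unfolding act4(2) using assms(2)
      by (intro eqns_measure_replace[where G = "{(t, Var X)}"])
        (auto simp: eqn_weight_def eqn_rank_def max.commute)
  next
    case (act5b X s1 s2)
    \<comment> \<open>The two equations are distinct, so at least one of them is an occurrence of
      \<open>X\<close> outside any candidate witness.\<close>
    have "\<not> solved_var X E"
    proof
      assume "solved_var X E"
      then obtain t where "X \<notin> vars_eqns (E - {(Var X, t)})" by (auto simp: solved_var_def)
      moreover have "(Var X, s1) \<in> E - {(Var X, t)} \<or> (Var X, s2) \<in> E - {(Var X, t)}"
        using act5b by auto
      ultimately show False using vars_eqns_lhsI[of "Var X" _ "E - {(Var X, t)}" X] by auto
    qed
    then show ?thesis unfolding act5b(2) using act5b assms(2) trm_size_pos[of s2]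
      by (intro eqns_measure_replace[where G = "{(Var X, s1), (Var X, s2)}"])
        (auto simp: eqn_weight_def eqn_rank_def Let_def max_def)
  qed (use assms(1) act5 act5a_imp_act5 in blast)+
qed

section \<open>Finiteness of runs\<close>

lemma run_Suc:
  "is_run A E n S L \<Longrightarrow> enat (Suc i) \<le> n \<Longrightarrow> L i \<in> A \<and> act (L i) (S i) (S (Suc i))"
  unfolding is_run_def by (metis Suc_ile_eq)

text \<open>No action starts from \<open>Failure\<close>, so it can only be the last state.\<close>

lemma run_Eqns:
  assumes "is_run A E n S L" "enat i < n"
  shows "\<exists>Ei. S i = Eqns Ei"
  using assms act_from_Failure by (metis is_run_def state.exhaust)

lemma run_finite:
  assumes "is_run A E n S L" "finite E" "enat i \<le> n" "S i = Eqns Ei"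
  shows "finite Ei"
  using assms(3,4)
proof (induction i arbitrary: Ei)
  case 0
  then show ?case using assms by (simp add: is_run_def)
next
  case (Suc i)
  then obtain Ei' where "S i = Eqns Ei'"
    using run_Eqns[OF assms(1)] by (meson Suc_ile_eq)
  then show ?case
    using Suc run_Suc[OF assms(1) Suc.prems(1)] act_finite by (metis Suc_ile_eq less_imp_le)
qed

lemma run_terminates:
  assumes run: "is_run A E n S L" and fin: "finite E"
  shows "\<exists>k. n = enat k"
proof (rule ccontr)
  assume "\<nexists>k. n = enat k"
  then have n: "enat i < n" for i by (cases n) auto
  define F where "F i = (THE Ei. S i = Eqns Ei)" for i
  have F: "S i = Eqns (F i)" for i using run_Eqns[OF run n, of i] by (auto simp: F_def)
  then have "finite (F i)" for i using run_finite[OF run fin] n less_imp_le by metis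
  moreover have "act (L i) (Eqns (F i)) (Eqns (F (Suc i)))" for i
    using run n F unfolding is_run_def by metis
  ultimately have "(eqns_measure (F (Suc i)), eqns_measure (F i)) \<in> measure_less" for i
    using act_decreases_measure by blast
  moreover have "wf measure_less" by (intro wf_lex_prod wf_less_than)
  ultimately show False unfolding wf_iff_no_infinite_down_chain
    by (auto dest: spec[of _ "\<lambda>i. eqns_measure (F i)"])
qed

section \<open>Tree congruences\<close>

text \<open>Only pairs of compound terms are constrained beyond equivalence. A variable may be
  related to a term properly containing it, so cyclic equations are not excluded.\<close>

definition tree_congruence :: "(('f, 'v) trm \<Rightarrow> ('f, 'v) trm \<Rightarrow> bool) \<Rightarrow> bool" where
  "tree_congruence R \<longleftrightarrow> equivp R \<and>
     (\<forall>f ss g ts. R (Fun f ss) (Fun g ts) \<longleftrightarrow> f = g \<and> list_all2 R ss ts)"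

definition satisfies :: "(('f, 'v) trm \<Rightarrow> ('f, 'v) trm \<Rightarrow> bool) \<Rightarrow> ('f, 'v) eqns \<Rightarrow> bool" where
  "satisfies R E \<longleftrightarrow> (\<forall>(s, t)\<in>E. R s t)"

lemma tree_congruence_Fun:
  "tree_congruence R \<Longrightarrow> R (Fun f ss) (Fun g ts) \<longleftrightarrow> f = g \<and> list_all2 R ss ts"
  by (simp add: tree_congruence_def)

lemma tree_congruence_refl: "tree_congruence R \<Longrightarrow> R t t"
  and tree_congruence_sym: "tree_congruence R \<Longrightarrow> R s t \<Longrightarrow> R t s"
  and tree_congruence_trans: "tree_congruence R \<Longrightarrow> R s t \<Longrightarrow> R t u \<Longrightarrow> R s u"
  unfolding tree_congruence_def by (meson equivp_reflp equivp_symp equivp_transp)+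

lemma tree_congruence_subst:
  assumes R: "tree_congruence R" and "R (Var X) t"
  shows "R s (app (Var(X := t)) s)"
proof (induction s)
  case (Var Y)
  then show ?case using assms by (simp add: tree_congruence_refl)
next
  case (Fun f ts)
  then show ?case using R by (simp add: tree_congruence_Fun list_all2_map2 list_all2_same)
qed

text \<open>Every term is related to its own instance, so symmetry and transitivity carry a relation
  between two terms to their instances and back.\<close>

lemma satisfies_app_eqns_iff:
  assumes R: "tree_congruence R" and "R (Var X) t"
  shows "satisfies R (app_eqns (Var(X := t)) E) \<longleftrightarrow> satisfies R E"
proof -
  let ?\<sigma> = "Var(X := t)"
  have "R (app ?\<sigma> s) (app ?\<sigma> u) \<longleftrightarrow> R s u" for s u
    using tree_congruence_subst[OF assms, of s] tree_congruence_subst[OF assms, of u]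
    by (meson R tree_congruence_sym tree_congruence_trans)
  then show ?thesis by (auto simp: satisfies_def app_eqns_def)
qed

lemma satisfies_insert:
  "satisfies R (insert (s, t) E) \<longleftrightarrow> R s t \<and> satisfies R E"
  by (auto simp: satisfies_def)

lemma satisfies_Un: "satisfies R (E \<union> F) \<longleftrightarrow> satisfies R E \<and> satisfies R F"
  by (auto simp: satisfies_def)

lemma satisfies_remove:
  "(s, t) \<in> E \<Longrightarrow> satisfies R E \<longleftrightarrow> R s t \<and> satisfies R (E - {(s, t)})"
  by (auto simp: satisfies_def)

lemma act_satisfies_iff:
  assumes "act a (Eqns E) (Eqns E')" and R: "tree_congruence R"
  shows "satisfies R E' \<longleftrightarrow> satisfies R E"
proof -
  have act5: ?thesis if "act Act5 (Eqns E) (Eqns E')"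
    using that
  proof cases
    case (act5 X t)
    then show ?thesis
      using satisfies_app_eqns_iff[OF R, of X t]
      by (auto simp: satisfies_remove[OF act5(2)] satisfies_insert satisfies_Un)
  qed
  show ?thesis using assms(1)
  proof cases
    case (act1 f ss ts)
    then have "satisfies R (set (zip ss ts)) \<longleftrightarrow> R (Fun f ss) (Fun f ts)"
      using R by (simp add: tree_congruence_Fun satisfies_def list_all2_iff)
    then show ?thesis by (auto simp: act1(2) satisfies_remove[OF act1(3)] satisfies_Un)
  next
    case (act3 X)
    then show ?thesis
      by (auto simp: satisfies_remove[OF act3(3)] tree_congruence_refl[OF R])
  next
    case (act4 t X)
    then show ?thesis
      by (auto simp: satisfies_remove[OF act4(3)] satisfies_insert
          intro: tree_congruence_sym[OF R])
  next
    case (act5b X s1 s2)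
    \<comment> \<open>The first equation stays in the set, so transitivity through \<open>s1\<close>
      recovers the replaced one.\<close>
    have "(Var X, s1) \<in> E - {(Var X, s2)}" using act5b by auto
    from satisfies_remove[OF this, of R]
    show ?thesis unfolding act5b(2) satisfies_remove[OF act5b(4)] satisfies_Un satisfies_insert
      by (auto simp: satisfies_def
          intro: tree_congruence_trans[OF R] tree_congruence_sym[OF R])
  qed (use assms(1) act5 act5a_imp_act5 in blast)+
qed

text \<open>A clash contradicts the decomposition property. Action 6 is excepted because equality of
  rational trees may relate \<open>X\<close> to a compound term containing \<open>X\<close>.\<close>

lemma act_Failure_not_satisfies:
  assumes "act a (Eqns E) Failure" "a \<noteq> Act6" and R: "tree_congruence R"
  shows "\<not> satisfies R E"
  using assms(1)
proof cases
  case (act2 f ss g ts)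
  then have "\<not> R (Fun f ss) (Fun g ts)"
    using R by (auto simp: tree_congruence_Fun dest: list_all2_lengthD)
  then show ?thesis using act2 by (auto simp: satisfies_def)
qed (use assms in auto)

lemma run_satisfies_iff:
  assumes run: "is_run A E n S L" and R: "tree_congruence R"
    and "enat i \<le> n" "S i = Eqns Ei"
  shows "satisfies R Ei \<longleftrightarrow> satisfies R E"
  using assms(3,4)
proof (induction i arbitrary: Ei)
  case 0
  then show ?case using run by (simp add: is_run_def)
next
  case (Suc i)
  then obtain Ei' where "S i = Eqns Ei'"
    using run_Eqns[OF run] by (meson Suc_ile_eq)
  then show ?case
    using Suc run_Suc[OF run Suc.prems(1)] act_satisfies_iff[OF _ R]
    by (metis Suc_ile_eq less_imp_le)
qed

lemma run_Failure_not_satisfies: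
  assumes run: "is_run A E (enat k) S L" and R: "tree_congruence R"
    and "S k = Failure" "\<And>i. i < k \<Longrightarrow> L i \<noteq> Act6"
  shows "\<not> satisfies R E"
proof -
  \<comment> \<open>The initial state is an equation set, so failure takes at least one
    action.\<close>
  obtain j where k: "k = Suc j"
    using run assms(3) by (cases k) (auto simp: is_run_def)
  obtain Ej where "S j = Eqns Ej" using run_Eqns[OF run, of j] k by auto
  then show ?thesis
    using run_Suc[OF run, of j] act_Failure_not_satisfies[OF _ _ R, of "L j" Ej]
      run_satisfies_iff[OF run R, of j Ej] assms(3,4) k by auto
qed

section \<open>Kernels of substitutions and preservation of unifiers\<close>

definition kernel :: "('f, 'v) subst \<Rightarrow> ('f, 'v) trm \<Rightarrow> ('f, 'v) trm \<Rightarrow> bool" where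
  "kernel \<sigma> s t \<longleftrightarrow> app \<sigma> s = app \<sigma> t"

lemma tree_congruence_kernel: "tree_congruence (kernel \<sigma>)"
  unfolding tree_congruence_def
proof (intro conjI allI)
  show "equivp (kernel \<sigma>)" by (intro equivpI reflpI sympI transpI) (auto simp: kernel_def)
next
  fix f g :: 'a and ss ts :: "('a, 'b) trm list"
  show "kernel \<sigma> (Fun f ss) (Fun g ts) \<longleftrightarrow> f = g \<and> list_all2 (kernel \<sigma>) ss ts"
    by (auto simp: kernel_def list_all2_conv_all_nth list_eq_iff_nth_eq)
qed

lemma is_unifier_iff: "is_unifier \<sigma> E \<longleftrightarrow> is_subst \<sigma> \<and> satisfies (kernel \<sigma>) E"
  by (simp add: is_unifier_def satisfies_def kernel_def)

lemma run_is_unifier_iff: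
  "is_run A E n S L \<Longrightarrow> enat i \<le> n \<Longrightarrow> S i = Eqns Ei \<Longrightarrow> is_unifier \<sigma> Ei \<longleftrightarrow> is_unifier \<sigma> E"
  using run_satisfies_iff[OF _ tree_congruence_kernel] by (metis is_unifier_iff)

lemma is_mgu_cong: "(\<And>\<sigma>. is_unifier \<sigma> E \<longleftrightarrow> is_unifier \<sigma> F) \<Longrightarrow> is_mgu \<theta> E \<longleftrightarrow> is_mgu \<theta> F"
  by (simp add: is_mgu_def)

section \<open>Semi-solved and solved forms\<close>

lemma occ_eqns_eq_1_iff:
  assumes "finite E" "(Var X, t) \<in> E" "X \<notin> vars t"
  shows "occ_eqns X E = 1 \<longleftrightarrow> X \<notin> vars_eqns (E - {(Var X, t)})"
proof -
  let ?D = "E - {(Var X, t)}"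
  have "occ_eqns X E = 1 + occ_eqns X ?D"
    using assms sum.remove[OF assms(1,2), of "\<lambda>(s, t). occ X s + occ X t"] occ_eq_0_iff[of X t]
    by (simp add: occ_eqns_def)
  moreover have "occ_eqns X ?D = 0 \<longleftrightarrow> X \<notin> vars_eqns ?D"
    using assms(1)
    by (simp add: occ_eqns_def vars_eqns_def case_prod_beta occ_eq_0_iff)
  ultimately show ?thesis by simp
qed

text \<open>Turns the counting clause into the form of the side conditions of actions 5 and
  5a.\<close>

lemma semi_solved_iff:
  "semi_solved E \<longleftrightarrow>
     finite E \<and>
     (\<forall>(s, t)\<in>E. is_Var s \<and> s \<noteq> t) \<and>
     (\<forall>X t u. (Var X, t) \<in> E \<longrightarrow> (Var X, u) \<in> E \<longrightarrow> t = u) \<and>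
     (\<forall>X Y. (Var X, Var Y) \<in> E \<longrightarrow> X \<notin> vars_eqns (E - {(Var X, Var Y)}))"
proof -
  have "(\<forall>X t. (Var X, t) \<in> E \<longrightarrow> is_Var t \<longrightarrow> occ_eqns X E = 1) \<longleftrightarrow>
      (\<forall>X Y. (Var X, Var Y) \<in> E \<longrightarrow> X \<notin> vars_eqns (E - {(Var X, Var Y)}))"
    if "finite E" "\<forall>(s, t)\<in>E. is_Var s \<and> s \<noteq> t"
  proof -
    have "occ_eqns X E = 1 \<longleftrightarrow> X \<notin> vars_eqns (E - {(Var X, Var Y)})" if "(Var X, Var Y) \<in> E" for X Y
      using that \<open>finite E\<close> \<open>\<forall>(s, t)\<in>E. is_Var s \<and> s \<noteq> t\<close>
      by (intro occ_eqns_eq_1_iff) auto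
    then show ?thesis by (metis is_Var_def)
  qed
  then show ?thesis unfolding semi_solved_def by blast
qed

lemma semi_solvedD:
  assumes "semi_solved E"
  shows "finite E"
    and "(s, t) \<in> E \<Longrightarrow> \<exists>X. s = Var X"
    and "(s, t) \<in> E \<Longrightarrow> s \<noteq> t"
    and "(Var X, t) \<in> E \<Longrightarrow> (Var X, u) \<in> E \<Longrightarrow> t = u"
    and "(Var X, Var Y) \<in> E \<Longrightarrow> X \<notin> vars_eqns (E - {(Var X, Var Y)})"
  using assms unfolding semi_solved_iff is_Var_def by blast+

text \<open>Serves both the final sets of MMA and semi-solved sets on which action 5 no longer
  applies.\<close>

lemma solved_if_no_var_elsewhere:
  assumes "finite E" "\<forall>(s, t)\<in>E. is_Var s"
    and once: "\<And>X t. (Var X, t) \<in> E \<Longrightarrow> X \<notin> vars t \<and> X \<notin> vars_eqns (E - {(Var X, t)})"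
  shows "solved E"
proof -
  have uniq: "(Var X, t) = (s, u)" if "(Var X, t) \<in> E" "(s, u) \<in> E" "X \<in> vars s \<union> vars u" for X t s u
    using once[OF that(1)] that vars_eqns_memD[of s u "E - {(Var X, t)}"] by blast
  have "semi_solved E" unfolding semi_solved_iff
  proof (intro conjI allI impI ballI)
    fix e assume "e \<in> E"
    then obtain X t where "e = (Var X, t)" "(Var X, t) \<in> E" using assms(2) by (auto simp: is_Var_def)
    then show "case e of (s, t) \<Rightarrow> is_Var s \<and> s \<noteq> t" using once[of X t] by auto
  next
    fix X t u assume "(Var X, t) \<in> E" "(Var X, u) \<in> E"
    then show "t = u" using uniq by fastforce
  qed (use assms once in auto)
  moreover have "X \<notin> vars u" if "(Var X, t) \<in> E" "(s, u) \<in> E" for X t s u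
    using uniq[OF that] once[OF that(1)] by blast
  ultimately show ?thesis by (auto simp: solved_def)
qed

section \<open>Equation sets to which no action applies\<close>

lemma terminal_lhs_is_Var:
  assumes st: "(s, t) \<in> E" and no: "\<And>a S'. a \<in> {Act1, Act2, Act4} \<Longrightarrow> \<not> act a (Eqns E) S'"
  shows "is_Var s"
proof (rule ccontr)
  assume s: "\<not> is_Var s"
  then obtain f ss where f: "s = Fun f ss" by (cases s) auto
  show False
  proof (cases t)
    case (Var X)
    then show False using act4[of s X E] st s no[of Act4] by blast
  next
    case (Fun g ts)
    then show False
      using act1[of f ss ts E] act2[of f ss g ts E] st f no[of Act1] no[of Act2] by blast
  qed
qed

lemma MMA_terminal_solved:
  assumes "finite E" and terminal: "\<not> (\<exists>a\<in>MMA. \<exists>S'. act a (Eqns E) S')"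
  shows "solved E"
proof (rule solved_if_no_var_elsewhere)
  have no: "\<not> act a (Eqns E) S'" if "a \<in> MMA" for a S' using terminal that by blast
  show "\<forall>(s, t)\<in>E. is_Var s"
    using no by (auto intro!: terminal_lhs_is_Var simp: MMA_def)
  fix X t assume Xt: "(Var X, t) \<in> E"
  \<comment> \<open>Otherwise action 3 applies if \<open>t\<close> is \<open>X\<close> itself, and
    action 6 if it is not.\<close>
  have "X \<notin> vars t"
    using Xt no[of Act3] no[of Act6] act3[of X E] act6[of X t E] by (auto simp: MMA_def)
  moreover from this have "X \<notin> vars_eqns (E - {(Var X, t)})"
    using Xt no[of Act5] act5[of X t E] by (auto simp: MMA_def)
  ultimately show "X \<notin> vars t \<and> X \<notin> vars_eqns (E - {(Var X, t)})" ..
qed (fact assms)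

lemma MMA_minus_terminal_semi_solved:
  assumes "finite E" and terminal: "\<not> (\<exists>a\<in>MMA_minus. \<exists>S'. act a (Eqns E) S')"
  shows "semi_solved E"
proof -
  have no: "\<not> act a (Eqns E) S'" if "a \<in> MMA_minus" for a S' using terminal that by blast
  have lhs: "is_Var s" if st: "(s, t) \<in> E" for s t
    using st no by (auto intro!: terminal_lhs_is_Var simp: MMA_minus_def)
  have "(Var X, Var X) \<notin> E" for X
    using no[of Act3] act3[of X E] by (auto simp: MMA_minus_def)
  then have neq: "s \<noteq> t" if st: "(s, t) \<in> E" for s t
    using st lhs[OF st] by (auto simp: is_Var_def)
  have once: "X \<notin> vars_eqns (E - {(Var X, Var Y)})" if "(Var X, Var Y) \<in> E" for X Y
    using that neq[OF that] no[of Act5a] act5a[of X Y E] by (auto simp: MMA_minus_def)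
  \<comment> \<open>A second equation for \<open>X\<close> would be another occurrence of
    \<open>X\<close>, which action 5a has ruled out. Only two compound right sides are left for
    action 5b.\<close>
  have var_unique: "u = Var Y" if "(Var X, Var Y) \<in> E" "(Var X, u) \<in> E" for X Y u
    using once[OF that(1)] that(2) vars_eqns_memD[of "Var X" u "E - {(Var X, Var Y)}"] by auto
  have "t = u" if tu: "(Var X, t) \<in> E" "(Var X, u) \<in> E" for X t u
  proof (cases "is_Var t \<or> is_Var u")
    case True
    then show ?thesis using var_unique tu by (metis is_Var_def)
  next
    case False
    then show ?thesis
      using tu no[of Act5b] act5b[of X t E u] act5b[of X u E t]
        nat_le_linear[of "trm_size t" "trm_size u"]
      by (auto simp: MMA_minus_def)
  qed
  then show ?thesis unfolding semi_solved_iff using assms(1) lhs neq once by blast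
qed

text \<open>As \<open>X\<close> occurs elsewhere, \<open>t\<close> must be compound. Since
  \<open>X\<close> has no second equation, the substitution touches right sides only, and a compound
  \<open>t\<close> creates no new equation between variables.\<close>

lemma act5_semi_solved:
  assumes "act Act5 (Eqns E) (Eqns E')" and E: "semi_solved E"
  shows "semi_solved E'"
  using assms(1)
proof cases
  case (act5 X t)
  let ?\<sigma> = "Var(X := t)" and ?D = "E - {(Var X, t)}"
  note E' = act5(1) and X = act5(2-4)
  have t: "\<not> is_Var t" using semi_solvedD(5)[OF E] X by (auto simp: is_Var_def)
  have D: "\<exists>Y. s = Var Y \<and> Y \<noteq> X" if "(s, u) \<in> ?D" for s u
    using that semi_solvedD(2)[OF E, of s u] semi_solvedD(4)[OF E X(1)] by blast
  have mem: "(s, u') \<in> E' \<longleftrightarrow> s = Var X \<and> u' = t \<or> (\<exists>u. (s, u) \<in> ?D \<and> u' = app ?\<sigma> u)" for s u'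
    using D unfolding E' app_eqns_def by (force simp: image_iff)
  have X_unique: "(Var X, u) \<notin> ?D" for u using D by blast
  have once: "Y \<notin> vars_eqns (?D - {(Var Y, Var Z)})" "Y \<notin> vars t" if "(Var Y, Var Z) \<in> ?D" for Y Z
  proof -
    have Y: "Y \<notin> vars_eqns (E - {(Var Y, Var Z)})" using semi_solvedD(5)[OF E] that by blast
    then show "Y \<notin> vars_eqns (?D - {(Var Y, Var Z)})"
      using vars_eqns_mono[of "?D - {(Var Y, Var Z)}" "E - {(Var Y, Var Z)}"] by blast
    have "(Var X, t) \<in> E - {(Var Y, Var Z)}" using X(1) t by auto
    from vars_eqns_rhsI[OF this] show "Y \<notin> vars t" using Y by blast
  qed
  have neq: "s \<noteq> u'" if su: "(s, u') \<in> E'" for s u'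
  proof -
    consider "s = Var X" "u' = t" | u where "(s, u) \<in> ?D" "u' = app ?\<sigma> u" using su mem by blast
    then show ?thesis
    proof cases
      case 2
      then obtain Y where "s = Var Y" "Y \<noteq> X" "s \<noteq> u" using D semi_solvedD(3)[OF E] by blast
      then show ?thesis using 2 t by (cases u) auto
    qed (use t in auto)
  qed
  show ?thesis unfolding semi_solved_iff
  proof (intro conjI allI impI ballI)
    show "finite E'" using act_finite assms semi_solvedD(1) by blast
  next
    fix e assume e: "e \<in> E'"
    obtain s u where su: "e = (s, u)" by (cases e)
    have "is_Var s" using mem[of s u] e su D by (auto simp: is_Var_def)
    then show "case e of (s, u) \<Rightarrow> is_Var s \<and> s \<noteq> u" using neq e su by auto
  next
    fix Y u v assume "(Var Y, u) \<in> E'" "(Var Y, v) \<in> E'"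
    then show "u = v" using mem X_unique semi_solvedD(4)[OF E] by (metis Diff_iff trm.inject(1))
  next
    fix Y Z assume YZ: "(Var Y, Var Z) \<in> E'"
    then obtain u where u: "(Var Y, u) \<in> ?D" "Var Z = app ?\<sigma> u" using mem t by auto
    then have uZ: "u = Var Z" "Z \<noteq> X" using t by (cases u; auto split: if_splits)+
    note Y = once[OF u(1)[unfolded uZ]]
    have "Y \<noteq> X" using u(1) D by blast
    have "E' - {(Var Y, Var Z)} \<subseteq> app_eqns ?\<sigma> (?D - {(Var Y, Var Z)}) \<union> {(Var X, t)}"
      using uZ \<open>Y \<noteq> X\<close> unfolding E' by (auto simp: app_eqns_def)
    moreover have "Y \<notin> vars_eqns (app_eqns ?\<sigma> (?D - {(Var Y, Var Z)}) \<union> {(Var X, t)})"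
      using Y \<open>Y \<noteq> X\<close> by (simp add: vars_eqns_app_upd)
    ultimately show "Y \<notin> vars_eqns (E' - {(Var Y, Var Z)})" using vars_eqns_mono by blast
  qed
qed

section \<open>Solved sets represent mgus\<close>

lemma represented_subst_eq:
  "semi_solved E \<Longrightarrow> (Var X, t) \<in> E \<Longrightarrow> represented_subst E X = t"
  unfolding represented_subst_def using semi_solvedD(4) by (auto intro!: the_equality)

lemma represented_subst_neq: "represented_subst E X \<noteq> Var X \<Longrightarrow> \<exists>t. (Var X, t) \<in> E"
  unfolding represented_subst_def by (auto split: if_splits)

lemma solved_is_mgu:
  assumes "solved E"
  shows "is_mgu (represented_subst E) E"
proof -
  let ?\<sigma> = "represented_subst E"
  have E: "semi_solved E" using assms by (simp add: solved_def)
  have "{X. ?\<sigma> X \<noteq> Var X} \<subseteq> vars_eqns E"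
    by (auto dest!: represented_subst_neq intro: vars_eqns_lhsI)
  then have "is_subst ?\<sigma>"
    unfolding is_subst_def using semi_solvedD(1)[OF E] finite_vars_eqns finite_subset by blast
  moreover have "app ?\<sigma> s = app ?\<sigma> t" if st: "(s, t) \<in> E" for s t
  proof -
    \<comment> \<open>In a solved set no variable moved by the substitution occurs on a right
      side.\<close>
    have "app ?\<sigma> t = t"
    proof (rule app_idI, rule ccontr)
      fix X assume "X \<in> vars t" "?\<sigma> X \<noteq> Var X"
      moreover from this obtain u where "(Var X, u) \<in> E" using represented_subst_neq[of E X] by blast
      ultimately show False using assms st unfolding solved_def by blast
    qed
    then show ?thesis using st semi_solvedD(2)[OF E st] represented_subst_eq[OF E] by auto
  qed
  ultimately have unif: "is_unifier ?\<sigma> E" by (auto simp: is_unifier_def)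
  \<comment> \<open>The unifier \<open>\<theta>\<close> itself serves as the factor
    \<open>\<tau>\<close>.\<close>
  have "\<theta> X = app \<theta> (?\<sigma> X)" if \<theta>: "is_unifier \<theta> E" for \<theta> X
  proof (cases "?\<sigma> X = Var X")
    case False
    then obtain t where "(Var X, t) \<in> E" using represented_subst_neq[of E X] by blast
    then show ?thesis using \<theta> represented_subst_eq[OF E] by (fastforce simp: is_unifier_def)
  qed simp
  then show ?thesis using unif unfolding is_mgu_def by (auto simp: is_unifier_def)
qed

lemma act5_run_yields_mgu:
  assumes E: "semi_solved E" "unifiable E" and run: "is_run {Act5} E m S L"
  shows "\<exists>j F. m = enat j \<and> S j = Eqns F \<and> solved F \<and> is_mgu (represented_subst F) E"
proof -
  obtain j where m: "m = enat j" using run_terminates[OF run semi_solvedD(1)[OF E(1)]] by blast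
  have "\<exists>F. S i = Eqns F \<and> semi_solved F" if "i \<le> j" for i
    using that
  proof (induction i)
    case 0
    then show ?case using run E by (simp add: is_run_def)
  next
    case (Suc i)
    then obtain F where F: "S i = Eqns F" "semi_solved F" by auto
    have act: "act Act5 (Eqns F) (S (Suc i))" using run_Suc[OF run, of i] F Suc m by auto
    then show ?case using act5_semi_solved F by (cases "S (Suc i)") (auto elim: act.cases)
  qed
  then obtain F where F: "S j = Eqns F" "semi_solved F" by blast
  have unif: "is_unifier \<sigma> F \<longleftrightarrow> is_unifier \<sigma> E" for \<sigma>
    using run_is_unifier_iff[OF run] F m by auto
  then have "unifiable F" using E by (simp add: unifiable_def)
  have no: "\<not> act Act5 (Eqns F) S'" for S' using run F m by (auto simp: is_run_def)
  have "solved F"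
  proof (rule solved_if_no_var_elsewhere)
    show "finite F" "\<forall>(s, t)\<in>F. is_Var s" using F(2) by (auto simp: semi_solved_iff)
    fix X t assume Xt: "(Var X, t) \<in> F"
    \<comment> \<open>Action 5 also gets stuck at cyclic equations; unifiability excludes
      these.\<close>
    have "X \<notin> vars t"
      using unifiable_occurs_check[OF \<open>unifiable F\<close> Xt] semi_solvedD(3)[OF F(2) Xt] by blast
    then show "X \<notin> vars t \<and> X \<notin> vars_eqns (F - {(Var X, t)})" using no act5[OF Xt] by blast
  qed
  then show ?thesis using m F(1) solved_is_mgu is_mgu_cong[OF unif] by blast
qed

section \<open>Rational trees of a semi-solved set\<close>

definition unfold_root :: "('f, 'v) eqns \<Rightarrow> ('f, 'v) trm \<Rightarrow> ('f, 'v) trm" where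
  "unfold_root E t = (case t of Var X \<Rightarrow> represented_subst E X | Fun f ts \<Rightarrow> t)"

text \<open>
  Two unfolding steps suffice: if \<open>X \<doteq> Y\<close> and \<open>Y \<doteq> t\<close> belong to a semi-solved set, then \<open>t\<close> is not
  a variable.
\<close>

definition tree_root :: "('f, 'v) eqns \<Rightarrow> ('f, 'v) trm \<Rightarrow> ('f, 'v) trm" where
  "tree_root E t = unfold_root E (unfold_root E t)"

text \<open>Coinductive because a cyclic equation such as X = f(X) describes an infinite
  tree.\<close>

coinductive tree_eq :: "('f, 'v) eqns \<Rightarrow> ('f, 'v) trm \<Rightarrow> ('f, 'v) trm \<Rightarrow> bool" for E where
  tree_eq_Var: "tree_root E s = Var X \<Longrightarrow> tree_root E t = Var X \<Longrightarrow> tree_eq E s t"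
| tree_eq_Fun: "tree_root E s = Fun f ss \<Longrightarrow> tree_root E t = Fun f ts \<Longrightarrow>
    list_all2 (tree_eq E) ss ts \<Longrightarrow> tree_eq E s t"

lemma tree_root_Fun [simp]: "tree_root E (Fun f ts) = Fun f ts"
  by (simp add: tree_root_def unfold_root_def)

lemma tree_eq_if_tree_root_eq:
  "tree_root E s = tree_root E t \<Longrightarrow> tree_eq E s t"
proof (coinduction arbitrary: s t)
  case tree_eq
  then show ?case by (cases "tree_root E t") (auto simp: list_all2_same)
qed

lemma tree_eq_sym: "tree_eq E s t \<Longrightarrow> tree_eq E t s"
proof (coinduction arbitrary: s t)
  case tree_eq
  then show ?case
    by cases (auto simp: list_all2_conv_all_nth)
qed

text \<open>Both hypotheses inspect the same root of \<open>t\<close>, so the cases and the argument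
  lists in the middle coincide.\<close>

lemma tree_eq_trans: "tree_eq E s t \<Longrightarrow> tree_eq E t u \<Longrightarrow> tree_eq E s u"
proof (coinduction arbitrary: s t u)
  case tree_eq
  from tree_eq(1) show ?case
  proof cases
    case (tree_eq_Var X)
    with tree_eq(2) show ?thesis by (auto elim: tree_eq.cases)
  next
    case (tree_eq_Fun f ss ts)
    from tree_eq(2) show ?thesis
      by cases (use tree_eq_Fun in \<open>auto simp: list_all2_conv_all_nth, blast\<close>)
  qed
qed

lemma tree_congruence_tree_eq: "tree_congruence (tree_eq E)"
  unfolding tree_congruence_def
proof (intro conjI allI)
  show "equivp (tree_eq E)"
    by (intro equivpI reflpI sympI transpI)
      (auto intro: tree_eq_if_tree_root_eq tree_eq_sym tree_eq_trans)
next
  fix f g :: 'a and ss ts :: "('a, 'b) trm list"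
  show "tree_eq E (Fun f ss) (Fun g ts) \<longleftrightarrow> f = g \<and> list_all2 (tree_eq E) ss ts"
    by (auto elim: tree_eq.cases intro: tree_eq_Fun)
qed

text \<open>One unfolding turns \<open>s\<close> into \<open>t\<close>, so it remains to see that a
  second unfolding of \<open>t\<close> changes nothing. If \<open>t\<close> is a variable
  \<open>Y\<close> with an equation of its own, then \<open>Y\<close> occurs elsewhere, so that
  equation has a compound right side.\<close>

lemma semi_solved_tree_root_eq:
  assumes E: "semi_solved E" and st: "(s, t) \<in> E"
  shows "tree_root E s = tree_root E t"
proof -
  obtain X where X: "s = Var X" using semi_solvedD(2)[OF E st] by blast
  have s: "unfold_root E s = t" using represented_subst_eq[OF E] st X by (simp add: unfold_root_def)
  show ?thesis
  proof (cases t)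
    case (Var Y)
    show ?thesis
    proof (cases "represented_subst E Y = Var Y")
      case False
      then obtain u where u: "(Var Y, u) \<in> E" using represented_subst_neq[of E Y] by blast
      have "\<not> is_Var u"
      proof
        assume "is_Var u"
        then have "Y \<notin> vars_eqns (E - {(Var Y, u)})"
          using semi_solvedD(5)[OF E] u by (auto simp: is_Var_def)
        moreover have "(s, t) \<in> E - {(Var Y, u)}" using st X Var semi_solvedD(3)[OF E st] by auto
        ultimately show False using Var vars_eqns_rhsI[of s t] by auto
      qed
      then show ?thesis using s Var represented_subst_eq[OF E u]
        by (cases u) (auto simp: tree_root_def unfold_root_def)
    qed (use s Var in \<open>simp add: tree_root_def unfold_root_def\<close>)
  qed (use s in \<open>simp add: tree_root_def unfold_root_def\<close>)
qed

lemma semi_solved_satisfies_tree_eq: "semi_solved E \<Longrightarrow> satisfies (tree_eq E) E"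
  by (auto simp: satisfies_def intro: tree_eq_if_tree_root_eq semi_solved_tree_root_eq)

section \<open>Soundness of MMA without occur-check\<close>

lemma MMA_minus_final_state:
  assumes run: "is_run MMA_minus E n S L" and fin: "finite E"
  obtains k where "n = enat k" "S k = Failure"
    | k F where "n = enat k" "S k = Eqns F" "semi_solved F"
proof -
  obtain k where k: "n = enat k" using run_terminates[OF run fin] by blast
  show ?thesis
  proof (cases "S k")
    case (Eqns F)
    then have "semi_solved F"
      using run k run_finite[OF run fin, of k F]
      by (intro MMA_minus_terminal_semi_solved) (auto simp: is_run_def)
    then show ?thesis using that k Eqns by blast
  qed (use that k in blast)
qed

lemma not_unifiable_not_satisfies:
  assumes run: "is_run MMA E n S L" and fin: "finite E"
    and no6: "\<And>i. enat i < n \<Longrightarrow> L i \<noteq> Act6"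
    and "\<not> unifiable E" and R: "tree_congruence R"
  shows "\<not> satisfies R E"
proof -
  obtain k where k: "n = enat k" using run_terminates[OF run fin] by blast
  \<comment> \<open>Any other end would be a solved set, whose represented substitution would unify
    \<open>E\<close>.\<close>
  have "S k = Failure"
  proof (cases "S k")
    case (Eqns F)
    then have "solved F"
      using run k run_finite[OF run fin, of k F]
      by (intro MMA_terminal_solved) (auto simp: is_run_def)
    then have "is_unifier (represented_subst F) F" using solved_is_mgu by (auto simp: is_mgu_def)
    then have "unifiable E"
      using run_is_unifier_iff[OF run _ Eqns] k by (auto simp: unifiable_def)
    then show ?thesis using assms by blast
  qed
  then show ?thesis using run_Failure_not_satisfies[OF run[unfolded k] R] no6 k by auto
qed

theorem theorem11:
  fixes E :: "('f, 'v) eqns"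
  assumes "finite E"
    and "\<exists>n S L. is_run MMA E n S L \<and> (\<forall>i. enat i < n \<longrightarrow> L i \<noteq> Act6)"
  shows "\<forall>n S L. is_run MMA_minus E n S L \<longrightarrow>
    (\<exists>k. n = enat k \<and>
      (\<not> unifiable E \<longrightarrow> S k = Failure) \<and>
      (unifiable E \<longrightarrow>
        (\<exists>E'. S k = Eqns E' \<and> unifiable E' \<and> semi_solved E' \<and>
          (\<forall>m S' L'. is_run {Act5} E' m S' L' \<longrightarrow>
            (\<exists>j E''. m = enat j \<and> S' j = Eqns E'' \<and> solved E'' \<and>
              is_mgu (represented_subst E'') E)))))"
proof (intro allI impI)
  fix n S L assume run: "is_run MMA_minus E n S L"
  show "\<exists>k. n = enat k \<and>
      (\<not> unifiable E \<longrightarrow> S k = Failure) \<and>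
      (unifiable E \<longrightarrow>
        (\<exists>E'. S k = Eqns E' \<and> unifiable E' \<and> semi_solved E' \<and>
          (\<forall>m S' L'. is_run {Act5} E' m S' L' \<longrightarrow>
            (\<exists>j E''. m = enat j \<and> S' j = Eqns E'' \<and> solved E'' \<and>
              is_mgu (represented_subst E'') E))))"
    using run assms(1)
  proof (cases rule: MMA_minus_final_state)
    case (1 k)
    have "\<not> is_unifier \<sigma> E" for \<sigma>
      using run_Failure_not_satisfies[OF run[unfolded 1(1)] tree_congruence_kernel 1(2)] run 1
      by (fastforce simp: is_unifier_iff is_run_def MMA_minus_def)
    then show ?thesis using 1 by (auto simp: unifiable_def)
  next
    case (2 k F)
    have unif: "is_unifier \<sigma> F \<longleftrightarrow> is_unifier \<sigma> E" for \<sigma>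
      using run_is_unifier_iff[OF run _ 2(2)] 2(1) by simp
    \<comment> \<open>Rational tree equality for the final set contains \<open>F\<close>, unifiable
      or not, and by invariance it contains \<open>E\<close>. The given run of MMA allows this only
      for unifiable \<open>E\<close>.\<close>
    have "satisfies (tree_eq F) E"
      using run_satisfies_iff[OF run tree_congruence_tree_eq _ 2(2)] 2
        semi_solved_satisfies_tree_eq by auto
    then have "unifiable E"
      using assms not_unifiable_not_satisfies[OF _ _ _ _ tree_congruence_tree_eq] by blast
    then have "unifiable F" using unif by (simp add: unifiable_def)
    then show ?thesis
      using 2 \<open>unifiable E\<close> act5_run_yields_mgu[OF 2(3)] is_mgu_cong[OF unif] by blast
  qed
qed

end
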